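(* For all $1\le u,v\le\infty$, one has $$A_1(u,v)=\max\Bigl\{\frac1v,\ 1-\frac1u,\ 1+\frac1v-\frac{2}{u}\Bigr\},$$ where $A_1(u,v)$ is the growth exponent of the horizontal Kakeya maximal operator $\mathcal{M}_{\mathbb{H}_1}$ in the first Heisenberg groups over finite fields, i.e. the smallest non-negative real number, independent of the field size $q$, for which there exists a constant $C_{u,v}>0$ (independent of $q$) with $$\|\mathcal{M}_{\mathbb{H}_1}F\|_{\ell^v(\mathbb{P}^{1}(\mathbb{F}_q))}\le C_{u,v}\, q^{A_1(u,v)}\,\|F\|_{\ell^u(\mathbb{H}_1(\mathbb{F}_q))}$$ for all odd prime powers $q$ and all $F:\mathbb{H}_1(\mathbb{F}_q)\to\mathbb{C}$.
   Context: Throughout, $q$ ranges over odd prime powers and $\mathbb{F}_q$ is the field with $q$ elements. The Heisenberg group $\mathbb{H}_1(\mathbb{F}_q)$ is the set $\mathbb{F}_q^3$ with group law $(x,y,t)\cdot(x',y',t')=(x+x',\,y+y',\,t+t'+(xy'-yx'))$. A horizontal direction is an element $[\mathbf{v}]\in\mathbb{P}^1(\mathbb{F}_q)$ represented by $\mathbf{v}=(a,b)\ne(0,0)$. For $\mathbf{p}=(x_0,y_0,t_0)\in\mathbb{H}_1(\mathbb{F}_q)$, the horizontal line through $\mathbf{p}$ in direction $[\mathbf{v}]$ is $L_{\mathbf{p},[\mathbf{v}]}=\{\mathbf{p}\cdot(sa,sb,0):s\in\mathbb{F}_q\}=\{(x_0+sa,\,y_0+sb,\,t_0+s(x_0b-y_0a)):s\in\mathbb{F}_q\}$.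 For $F:\mathbb{H}_1(\mathbb{F}_q)\to\mathbb{C}$ the maximal operator (with sums, not averages) is $$\mathcal{M}_{\mathbb{H}_1}F([\mathbf{v}]):=\max_{\mathbf{p}\in\mathbb{H}_1(\mathbb{F}_q)}\sum_{\mathbf{x}\in L_{\mathbf{p},[\mathbf{v}]}}|F(\mathbf{x})|,\qquad[\mathbf{v}]\in\mathbb{P}^1(\mathbb{F}_q).$$ For a finite set $X$, $\ell^p(X)$ is the space of complex-valued functions on $X$ with the $\ell^p$-norm with respect to counting measure. Convention: $1/\infty=0$. *)

theory Defs
  imports
    Complex_Main
    "HOL-Library.Extended_Real"
    "HOL-Algebra.Ring"
    "HOL-Number_Theory.Prime_Powers"
begin

definition heisenberg_group :: "('a, 'm) ring_scheme \<Rightarrow> ('a \<times> 'a \<times> 'a) monoid" where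
  "heisenberg_group R =
     \<lparr>carrier = carrier R \<times> carrier R \<times> carrier R,
      monoid.mult = (\<lambda>(x, y, t) (x', y', t').
        (x \<oplus>\<^bsub>R\<^esub> x', y \<oplus>\<^bsub>R\<^esub> y',
         (t \<oplus>\<^bsub>R\<^esub> t') \<oplus>\<^bsub>R\<^esub> ((x \<otimes>\<^bsub>R\<^esub> y') \<ominus>\<^bsub>R\<^esub> (y \<otimes>\<^bsub>R\<^esub> x')))),
      one = (\<zero>\<^bsub>R\<^esub>, \<zero>\<^bsub>R\<^esub>, \<zero>\<^bsub>R\<^esub>)\<rparr>"

lemma heisenberg_group_is_group:
  fixes R (structure)
  assumes "cring R"
  shows "group (heisenberg_group R)"
proof -
  interpret cring R by fact
  have inv: "\<ominus> x \<otimes> y \<ominus> (\<ominus> y \<otimes> x) = \<zero>"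
    if "x \<in> carrier R" "y \<in> carrier R" for x y
    using that by (simp add: l_minus m_comm[of y x] minus_eq r_neg l_neg)
  have assoc: "(t \<oplus> t' \<oplus> (x \<otimes> y' \<ominus> y \<otimes> x')) \<oplus> t'' \<oplus>
        ((x \<oplus> x') \<otimes> y'' \<ominus> (y \<oplus> y') \<otimes> x'') =
      t \<oplus> (t' \<oplus> t'' \<oplus> (x' \<otimes> y'' \<ominus> y' \<otimes> x'')) \<oplus>
        (x \<otimes> (y' \<oplus> y'') \<ominus> y \<otimes> (x' \<oplus> x''))"
    if "x \<in> carrier R" "y \<in> carrier R" "t \<in> carrier R"
      "x' \<in> carrier R" "y' \<in> carrier R" "t' \<in> carrier R"
      "x'' \<in> carrier R" "y'' \<in> carrier R" "t'' \<in> carrier R"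
    for x y t x' y' t' x'' y'' t''
    using that by (simp add: minus_eq l_distr r_distr minus_add a_assoc a_comm a_lcomm)
  show ?thesis
  proof (rule groupI)
    fix p assume "p \<in> carrier (heisenberg_group R)"
    then obtain x y t where "p = (x, y, t)" "x \<in> carrier R" "y \<in> carrier R" "t \<in> carrier R"
      by (auto simp: heisenberg_group_def)
    then show "\<exists>r\<in>carrier (heisenberg_group R).
        r \<otimes>\<^bsub>heisenberg_group R\<^esub> p = \<one>\<^bsub>heisenberg_group R\<^esub>"
      by (intro bexI[of _ "(\<ominus> x, \<ominus> y, \<ominus> t)"])
        (simp_all add: heisenberg_group_def l_neg inv)
  next
    fix p q r
    assume "p \<in> carrier (heisenberg_group R)" "q \<in> carrier (heisenberg_group R)"
      "r \<in> carrier (heisenberg_group R)"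
    then show "p \<otimes>\<^bsub>heisenberg_group R\<^esub> q \<otimes>\<^bsub>heisenberg_group R\<^esub> r =
        p \<otimes>\<^bsub>heisenberg_group R\<^esub> (q \<otimes>\<^bsub>heisenberg_group R\<^esub> r)"
      by (clarsimp simp: heisenberg_group_def) (intro conjI a_assoc assoc)
  qed (auto simp: heisenberg_group_def minus_eq r_neg)
qed

definition nonzero_vectors :: "('a, 'm) ring_scheme \<Rightarrow> ('a \<times> 'a) set" where
  "nonzero_vectors R = carrier R \<times> carrier R - {(\<zero>\<^bsub>R\<^esub>, \<zero>\<^bsub>R\<^esub>)}"

definition proportional :: "('a, 'm) ring_scheme \<Rightarrow> (('a \<times> 'a) \<times> ('a \<times> 'a)) set" where
  "proportional R =
     {(v, w). v \<in> nonzero_vectors R \<and> w \<in> nonzero_vectors R \<and>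
        (\<exists>c \<in> carrier R - {\<zero>\<^bsub>R\<^esub>}. w = (c \<otimes>\<^bsub>R\<^esub> fst v, c \<otimes>\<^bsub>R\<^esub> snd v))}"

definition proj_line :: "('a, 'm) ring_scheme \<Rightarrow> ('a \<times> 'a) set set" where
  "proj_line R = nonzero_vectors R // proportional R"

definition horizontal_line ::
    "('a, 'm) ring_scheme \<Rightarrow> 'a \<times> 'a \<times> 'a \<Rightarrow> 'a \<times> 'a \<Rightarrow> ('a \<times> 'a \<times> 'a) set" where
  "horizontal_line R p v =
     {p \<otimes>\<^bsub>heisenberg_group R\<^esub> (s \<otimes>\<^bsub>R\<^esub> fst v, s \<otimes>\<^bsub>R\<^esub> snd v, \<zero>\<^bsub>R\<^esub>) | s. s \<in> carrier R}"

lemma horizontal_line_proportional: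
  fixes R (structure)
  assumes "field R" and "(v, w) \<in> proportional R"
  shows "horizontal_line R p v = horizontal_line R p w"
proof -
  interpret field R by fact
  have "v \<in> nonzero_vectors R"
      "\<exists>c\<in>carrier R - {\<zero>}. w = (c \<otimes> fst v, c \<otimes> snd v)"
    using assms(2) unfolding proportional_def by blast+
  then obtain c where c: "c \<in> carrier R" "c \<noteq> \<zero>"
      and w: "w = (c \<otimes> fst v, c \<otimes> snd v)"
      and v: "fst v \<in> carrier R" "snd v \<in> carrier R"
    unfolding nonzero_vectors_def mem_Times_iff Diff_iff by blast
  have inv: "inv c \<in> carrier R" "inv c \<otimes> c = \<one>"
    using c field_Units by simp_all
  show ?thesis
  proof (intro equalityI subsetI)
    fix x assume "x \<in> horizontal_line R p v"
    then obtain s where s: "s \<in> carrier R"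
        "x = p \<otimes>\<^bsub>heisenberg_group R\<^esub> (s \<otimes> fst v, s \<otimes> snd v, \<zero>)"
      by (auto simp: horizontal_line_def)
    have eq: "(s \<otimes> inv c) \<otimes> (c \<otimes> z) = s \<otimes> z" if "z \<in> carrier R" for z
    proof -
      have "(s \<otimes> inv c) \<otimes> (c \<otimes> z) = s \<otimes> (inv c \<otimes> c) \<otimes> z"
        using s(1) c inv(1) that by (simp add: m_assoc)
      then show ?thesis using s(1) inv(2) by simp
    qed
    have "x = p \<otimes>\<^bsub>heisenberg_group R\<^esub>
        ((s \<otimes> inv c) \<otimes> fst w, (s \<otimes> inv c) \<otimes> snd w, \<zero>)"
      by (simp only: s(2) w fst_conv snd_conv eq v)
    moreover have "s \<otimes> inv c \<in> carrier R" using s(1) inv(1) by (rule m_closed)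
    ultimately show "x \<in> horizontal_line R p w"
      unfolding horizontal_line_def mem_Collect_eq by (intro exI conjI)
  next
    fix x assume "x \<in> horizontal_line R p w"
    then obtain s where s: "s \<in> carrier R"
        "x = p \<otimes>\<^bsub>heisenberg_group R\<^esub> (s \<otimes> fst w, s \<otimes> snd w, \<zero>)"
      by (auto simp: horizontal_line_def)
    then have "x = p \<otimes>\<^bsub>heisenberg_group R\<^esub>
        ((s \<otimes> c) \<otimes> fst v, (s \<otimes> c) \<otimes> snd v, \<zero>)"
      using w v c by (simp add: m_assoc)
    moreover have "s \<otimes> c \<in> carrier R" using s(1) c(1) by (rule m_closed)
    ultimately show "x \<in> horizontal_line R p v"
      unfolding horizontal_line_def mem_Collect_eq by (intro exI conjI)
  qed
qed

text \<open>
  The line depends only on the class of the direction vector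
  (\<open>horizontal_line_proportional\<close>), so choosing a representative below is harmless.
\<close>

definition kakeya_maximal ::
    "('a, 'm) ring_scheme \<Rightarrow> ('a \<times> 'a \<times> 'a \<Rightarrow> complex) \<Rightarrow> ('a \<times> 'a) set \<Rightarrow> real" where
  "kakeya_maximal R F d =
     Max ((\<lambda>p. \<Sum>x \<in> horizontal_line R p (SOME v. v \<in> d). cmod (F x))
            ` carrier (heisenberg_group R))"

text \<open>
  Functions on a finite nonempty set \<open>X\<close> are represented by total functions, of which only
  the values on \<open>X\<close> matter.  Exponents are meant in the range from 1 to \<open>\<infinity>\<close>; then
  \<open>0 powr a = 0\<close> agrees with the usual convention.
\<close>

definition lp_norm :: "ereal \<Rightarrow> 'a set \<Rightarrow> ('a \<Rightarrow> 'b::real_normed_vector) \<Rightarrow> real" where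
  "lp_norm p X f =
     (if p = \<infinity> then Max ((\<lambda>x. norm (f x)) ` X)
      else (\<Sum>x\<in>X. norm (f x) powr real_of_ereal p) powr (1 / real_of_ereal p))"

text \<open>
  Uniformity in the field requires quantifying over all finite fields inside a formula.  They
  are represented as ring records on subsets of one fixed countably infinite type: every
  finite field is isomorphic to such a record, and \<open>residue_ring p\<close> is literally one.
\<close>

definition kakeya_bound :: "ereal \<Rightarrow> ereal \<Rightarrow> real \<Rightarrow> bool" where
  "kakeya_bound u v A \<longleftrightarrow>
     (\<exists>C>0. \<forall>q::nat. odd q \<and> primepow q \<longrightarrow>
        (\<forall>R :: int ring. field R \<and> card (carrier R) = q \<longrightarrow>
          (\<forall>F :: int \<times> int \<times> int \<Rightarrow> complex.
             lp_norm v (proj_line R) (kakeya_maximal R F)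
               \<le> C * real q powr A * lp_norm u (carrier (heisenberg_group R)) F)))"

definition is_growth_exponent :: "ereal \<Rightarrow> ereal \<Rightarrow> real \<Rightarrow> bool" where
  "is_growth_exponent u v A \<longleftrightarrow>
     0 \<le> A \<and> kakeya_bound u v A \<and> (\<forall>B. 0 \<le> B \<and> kakeya_bound u v B \<longrightarrow> A \<le> B)"

end

theory Submission
  imports Defs "HOL-Analysis.Convex" "HOL-Number_Theory.Residues"
begin

text \<open>
  Two horizontal lines with distinct directions meet in at most one point, so a \<open>TT\<^sup>*\<close> argument
  bounds the maximal operator from \<open>\<ell>\<^sup>2\<close> to \<open>\<ell>\<^sup>2\<close> with norm of order \<open>q\<^bsup>1/2\<^esup>\<close>.
  Instead of interpolating, one applies this bound to \<open>|F|\<^bsup>u/2\<^esup>\<close>: Hoelder's inequality on each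
  line then gives \<open>\<ell>\<^sup>u \<rightarrow> \<ell>\<^sup>w\<close> with norm of order \<open>q\<^bsup>1 - 1/u\<^esup>\<close>, where
  \<open>1/w = min (1/u) (1 - 1/u)\<close>, and the nesting of the \<open>\<ell>\<^sup>v\<close> norms yields all other \<open>v\<close>.
  The three lower bounds come from the indicator functions of the origin, of one line through the
  origin, and of the plane \<open>t = 0\<close>, which contains a line in every direction.
\<close>

section \<open>Inequalities between finite sums and \<open>\<ell>\<^sup>p\<close> norms\<close>

text \<open>Hoelder's inequality with conjugate exponents \<open>1/a\<close> and \<open>1/b\<close>:
  after both sums are normalised to 1, Young's inequality holds term by term. If a sum vanishes or
  \<open>X\<close> is infinite, the left side is 0.\<close>

lemma sum_powr_mult_le:
  fixes g h :: "'a \<Rightarrow> real"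
  assumes "\<And>x. x \<in> X \<Longrightarrow> 0 \<le> g x" "\<And>x. x \<in> X \<Longrightarrow> 0 \<le> h x"
    and ab: "0 < a" "0 < b" "a + b = 1"
  shows "(\<Sum>x\<in>X. g x powr a * h x powr b) \<le> (\<Sum>x\<in>X. g x) powr a * (\<Sum>x\<in>X. h x) powr b"
proof -
  define G H where "G = sum g X" and "H = sum h X"
  have nn: "0 \<le> G" "0 \<le> H" using assms by (auto simp: G_def H_def sum_nonneg)
  show ?thesis
  proof (cases "finite X \<and> 0 < G \<and> 0 < H")
    case False
    have "(\<Sum>x\<in>X. g x powr a * h x powr b) = 0"
    proof (cases "finite X")
      case True
      then have "G = 0 \<or> H = 0" using False nn by linarith
      then have "(\<forall>x\<in>X. g x = 0) \<or> (\<forall>x\<in>X. h x = 0)"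
        using assms True by (simp add: G_def H_def sum_nonneg_eq_0_iff)
      then show ?thesis by auto
    qed simp
    then show ?thesis by (simp add: sum_nonneg)
  next
    case True
    then have GH: "0 < G" "0 < H" "finite X" by auto
    have "(\<Sum>x\<in>X. (g x / G) powr a * (h x / H) powr b) \<le> (\<Sum>x\<in>X. a * (g x / G) + b * (h x / H))"
    proof (rule sum_mono)
      fix x assume x: "x \<in> X"
      show "(g x / G) powr a * (h x / H) powr b \<le> a * (g x / G) + b * (h x / H)"
      proof (cases "g x = 0 \<or> h x = 0")
        case True
        then show ?thesis using assms(1,2)[OF x] GH ab by auto
      next
        case False
        then show ?thesis
          using assms(1,2)[OF x] GH ab by (intro Youngs_inequality_0) (auto simp: less_le)
      qed
    qed
    also have "\<dots> = a * (G / G) + b * (H / H)"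
      by (simp add: sum.distrib G_def H_def flip: sum_divide_distrib sum_distrib_left)
    also have "\<dots> = 1" using GH ab by simp
    finally have "(\<Sum>x\<in>X. (g x / G) powr a * (h x / H) powr b) \<le> 1" .
    moreover have "(\<Sum>x\<in>X. (g x / G) powr a * (h x / H) powr b)
        = (\<Sum>x\<in>X. g x powr a * h x powr b) / (G powr a * H powr b)"
      using assms GH by (simp add: powr_divide sum_divide_distrib)
    ultimately show ?thesis using GH by (simp add: G_def[symmetric] H_def[symmetric] divide_le_eq)
  qed
qed

text \<open>Hoelder against the constant function 1. The endpoint \<open>s = 1\<close> is separate
  because \<open>sum_powr_mult_le\<close> needs both exponents positive.\<close>

lemma sum_le_card_powr_mult:
  fixes g :: "'a \<Rightarrow> real"
  assumes "\<And>x. x \<in> X \<Longrightarrow> 0 \<le> g x" and "1 \<le> s"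
  shows "(\<Sum>x\<in>X. g x) \<le> real (card X) powr (1 - 1/s) * (\<Sum>x\<in>X. g x powr s) powr (1/s)"
proof (cases "s = 1")
  case True
  \<comment> \<open>Since \<open>0 powr 0 = 0\<close>, the factor \<open>card X powr 0\<close> is 1
    only if \<open>card X\<close> is nonzero.\<close>
  then show ?thesis using assms by (cases "card X = 0") (auto simp: sum_nonneg card_eq_0_iff)
next
  case False
  with assms have s: "1 < s" by simp
  have "(\<Sum>x\<in>X. g x) = (\<Sum>x\<in>X. (g x powr s) powr (1/s) * 1 powr (1 - 1/s))"
    using assms s by (intro sum.cong) (auto simp: powr_powr)
  also have "\<dots> \<le> (\<Sum>x\<in>X. g x powr s) powr (1/s) * (\<Sum>x\<in>X. 1) powr (1 - 1/s)"
    using s by (intro sum_powr_mult_le) (auto simp: field_simps)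
  finally show ?thesis by (simp add: mult.commute)
qed

section \<open>Comparison of \<open>lp_norm\<close> for different exponents, including
  infinity\<close>

lemma real_of_ereal_inverse: "r \<noteq> 0 \<Longrightarrow> real_of_ereal (1 / ereal r) = 1 / r"
  by (simp add: one_ereal_def)

lemma lp_norm_ereal:
  "lp_norm (ereal r) X f = (\<Sum>x\<in>X. norm (f x) powr r) powr (1 / r)"
  by (simp add: lp_norm_def)

lemma lp_norm_nonneg: "finite X \<Longrightarrow> X \<noteq> {} \<Longrightarrow> 0 \<le> lp_norm p X f"
  by (auto simp: lp_norm_def Max_ge_iff)

lemma norm_le_lp_norm:
  assumes "finite X" "x \<in> X" "1 \<le> p"
  shows "norm (f x) \<le> lp_norm p X f"
proof (cases p)
  case (real r)
  with assms have r: "1 \<le> r" by simp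
  have "norm (f x) = (norm (f x) powr r) powr (1 / r)" using r by (simp add: powr_powr)
  also have "\<dots> \<le> (\<Sum>x\<in>X. norm (f x) powr r) powr (1 / r)"
    using assms r by (intro powr_mono2 member_le_sum) auto
  finally show ?thesis by (simp add: real lp_norm_ereal)
next
  case PInf
  then show ?thesis using assms by (auto simp: lp_norm_def)
qed (use assms in auto)

text \<open>For finite exponents \<open>r \<le> s\<close> this is Hoelder for \<open>|f|^r\<close>
  with exponent \<open>s/r\<close>. For \<open>w = \<infinity>\<close> every value is bounded by the
  maximum, and \<open>real_of_ereal (1 / \<infinity>) = 0\<close> makes the formula uniform.\<close>

lemma lp_norm_le_card_powr_mult:
  assumes X: "finite X" "X \<noteq> {}" and "1 \<le> v" "v \<le> w"
  shows "lp_norm v X f \<le>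
    real (card X) powr (real_of_ereal (1 / v) - real_of_ereal (1 / w)) * lp_norm w X f"
proof (cases v)
  case (real r)
  with assms have r: "1 \<le> r" by simp
  show ?thesis
  proof (cases w)
    case w: (real s)
    with assms real have s: "r \<le> s" by simp
    have "(\<Sum>x\<in>X. norm (f x) powr r)
        \<le> real (card X) powr (1 - 1/(s/r)) * (\<Sum>x\<in>X. (norm (f x) powr r) powr (s/r)) powr (1/(s/r))"
      using r s by (intro sum_le_card_powr_mult) auto
    also have "(\<Sum>x\<in>X. (norm (f x) powr r) powr (s/r)) = (\<Sum>x\<in>X. norm (f x) powr s)"
      using r by (simp add: powr_powr)
    finally have "(\<Sum>x\<in>X. norm (f x) powr r) powr (1/r)
        \<le> (real (card X) powr (1 - r/s) * (\<Sum>x\<in>X. norm (f x) powr s) powr (r/s)) powr (1/r)"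
      using r by (intro powr_mono2) (auto simp: sum_nonneg)
    also have "\<dots> = real (card X) powr (1/r - 1/s) * (\<Sum>x\<in>X. norm (f x) powr s) powr (1/s)"
      using r s by (simp add: powr_mult powr_powr sum_nonneg field_simps)
    finally show ?thesis using r s by (simp add: real w lp_norm_ereal real_of_ereal_inverse)
  next
    case PInf
    have "(\<Sum>x\<in>X. norm (f x) powr r) \<le> (\<Sum>x\<in>X. lp_norm \<infinity> X f powr r)"
      using r X by (intro sum_mono powr_mono2 norm_le_lp_norm) auto
    then have "(\<Sum>x\<in>X. norm (f x) powr r) powr (1/r) \<le> (card X * lp_norm \<infinity> X f powr r) powr (1/r)"
      using r by (intro powr_mono2) (auto simp: sum_nonneg)
    also have "\<dots> = real (card X) powr (1/r) * lp_norm \<infinity> X f"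
      using r X by (simp add: powr_mult powr_powr lp_norm_nonneg)
    finally show ?thesis using r by (simp add: real PInf lp_norm_ereal real_of_ereal_inverse)
  qed (use assms in auto)
next
  case PInf
  then show ?thesis using assms by auto
qed (use assms in auto)

text \<open>Every value is at most \<open>N\<close>, the norm with the smaller exponent
  \<open>r\<close>, so \<open>|f|^s \<le> |f|^r N^(s-r)\<close>; summation gives
  \<open>N^s\<close>.\<close>

lemma lp_norm_antimono:
  assumes X: "finite X" "X \<noteq> {}" and "1 \<le> w" "w \<le> v"
  shows "lp_norm v X f \<le> lp_norm w X f"
proof (cases v)
  case (real s)
  with assms obtain r where w: "w = ereal r" by (cases w) auto
  with assms real have r: "1 \<le> r" "r \<le> s" by auto
  define N where "N = lp_norm w X f"
  have N: "0 \<le> N" using X by (simp add: N_def lp_norm_nonneg)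
  have "(\<Sum>x\<in>X. norm (f x) powr s) \<le> (\<Sum>x\<in>X. norm (f x) powr r * N powr (s - r))"
  proof (rule sum_mono)
    fix x assume "x \<in> X"
    then have "norm (f x) powr (s - r) \<le> N powr (s - r)"
      using assms r unfolding N_def by (intro powr_mono2 norm_le_lp_norm) auto
    then have "norm (f x) powr r * norm (f x) powr (s - r) \<le> norm (f x) powr r * N powr (s - r)"
      by (rule mult_left_mono) simp
    then show "norm (f x) powr s \<le> norm (f x) powr r * N powr (s - r)"
      by (simp add: powr_add[symmetric])
  qed
  also have "\<dots> = N powr r * N powr (s - r)"
    using r X by (simp add: N_def w lp_norm_ereal powr_powr sum_nonneg sum_distrib_right)
  also have "\<dots> = N powr s" by (simp add: powr_add[symmetric])
  finally have "(\<Sum>x\<in>X. norm (f x) powr s) powr (1/s) \<le> (N powr s) powr (1/s)"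
    using r by (intro powr_mono2) (auto simp: sum_nonneg)
  then show ?thesis using r N by (simp add: real lp_norm_ereal powr_powr N_def)
next
  case PInf
  then show ?thesis using assms norm_le_lp_norm[of X _ w f] by (auto simp: lp_norm_def[of \<infinity>])
qed (use assms in auto)

text \<open>For test functions: \<open>Y\<close> will be a set of directions in which the maximal
  function is at least \<open>c\<close>.\<close>

lemma lp_norm_ge:
  assumes X: "finite X" "Y \<subseteq> X" "Y \<noteq> {}" and v: "1 \<le> v" and c: "0 \<le> c"
    and le: "\<And>x. x \<in> Y \<Longrightarrow> c \<le> norm (f x)"
  shows "c * real (card Y) powr real_of_ereal (1 / v) \<le> lp_norm v X f"
proof (cases v)
  case (real r)
  with v have r: "1 \<le> r" by simp
  have "card Y * c powr r = (\<Sum>x\<in>Y. c powr r)" by simp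
  also have "\<dots> \<le> (\<Sum>x\<in>Y. norm (f x) powr r)"
    using r c le by (intro sum_mono powr_mono2) auto
  also have "\<dots> \<le> (\<Sum>x\<in>X. norm (f x) powr r)"
    using X by (intro sum_mono2) auto
  finally have "(card Y * c powr r) powr (1/r) \<le> (\<Sum>x\<in>X. norm (f x) powr r) powr (1/r)"
    using r by (intro powr_mono2) auto
  then show ?thesis
    using r c by (simp add: real lp_norm_ereal real_of_ereal_inverse powr_mult powr_powr mult.commute)
next
  case PInf
  obtain x where x: "x \<in> Y" using X by auto
  have "c \<le> lp_norm v X f"
    using le[OF x] norm_le_lp_norm[of X x v f] X v x by auto
  moreover have "card Y \<noteq> 0" using X by (metis card_0_eq finite_subset)
  ultimately show ?thesis using PInf by simp
qed (use v in auto)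

lemma lp_norm_of_bool:
  assumes X: "finite X" "S \<subseteq> X" "S \<noteq> {}" and u: "1 \<le> u"
  shows "lp_norm u X (\<lambda>x. of_bool (x \<in> S) :: 'b::real_normed_algebra_1)
    = real (card S) powr real_of_ereal (1 / u)"
proof -
  have 1: "norm (of_bool P :: 'b) = of_bool P" for P by (cases P) auto
  show ?thesis
  proof (cases u)
    case (real r)
    have "(of_bool P :: real) powr r = of_bool P" for P by (cases P) auto
    moreover have "X \<inter> S = S" using X by auto
    ultimately show ?thesis using real u X by (auto simp: lp_norm_ereal real_of_ereal_inverse 1)
  next
    case PInf
    have "card S \<noteq> 0" using X by (metis card_0_eq finite_subset)
    moreover have "Max ((\<lambda>x. of_bool (x \<in> S) :: real) ` X) = 1"
      using X by (intro Max_eqI) auto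
    ultimately show ?thesis using PInf by (simp add: lp_norm_def 1)
  qed (use u in auto)
qed

section \<open>Families of lines with small intersections\<close>

text \<open>Converts the squares produced by the \<open>l^2\<close> bound for
  \<open>|f|^(r/2)\<close> back into the \<open>l^r\<close> norm of \<open>f\<close>.\<close>

lemma powr_half_squared: "(norm z powr (r / 2))\<^sup>2 = norm z powr r"
  by (cases "z = 0") (simp_all add: powr_power)

text \<open>Only incidence counts enter the upper bound. In the application \<open>D\<close> is the
  set of directions, \<open>X\<close> the Heisenberg group, \<open>L d\<close> a line attaining the
  maximum in direction \<open>d\<close>, and \<open>N\<close> the field size; the bound
  \<open>2 * N\<close> leaves room for the \<open>N + 1\<close> directions.\<close>

locale line_family =
  fixes D :: "'d set" and X :: "'a set" and L :: "'d \<Rightarrow> 'a set" and N :: nat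
  assumes fin_D: "finite D" and D_ne: "D \<noteq> {}" and card_D: "card D \<le> 2 * N"
    and fin_X: "finite X" and X_ne: "X \<noteq> {}"
    and L_sub: "d \<in> D \<Longrightarrow> L d \<subseteq> X"
    and card_L: "d \<in> D \<Longrightarrow> card (L d) \<le> N"
    and card_inter: "d \<in> D \<Longrightarrow> e \<in> D \<Longrightarrow> d \<noteq> e \<Longrightarrow> card (L d \<inter> L e) \<le> 1"
begin

lemma N_ge_1: "1 \<le> real N"
  using card_D D_ne fin_D by (cases N) auto

text \<open>A \<open>TT\<^sup>*\<close> argument: the sum is paired with the adjoint \<open>g\<close> of the line sums, whose
  square only sees the intersections of pairs of lines.\<close>
lemma sum_line_sums_squared_le:
  fixes f :: "'a \<Rightarrow> real"
  shows "(\<Sum>d\<in>D. (\<Sum>x\<in>L d. f x)\<^sup>2) \<le> 3 * N * (\<Sum>x\<in>X. (f x)\<^sup>2)"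
proof -
  define a where "a d = (\<Sum>x\<in>L d. f x)" for d
  define S where "S = (\<Sum>d\<in>D. (a d)\<^sup>2)"
  define g where "g x = (\<Sum>d\<in>D. a d * of_bool (x \<in> L d))" for x
  have S0: "0 \<le> S" by (simp add: S_def sum_nonneg)
  have a_eq: "a d = (\<Sum>x\<in>X. f x * of_bool (x \<in> L d))" if "d \<in> D" for d
    unfolding a_def using L_sub[OF that] fin_X
    by (intro sum.mono_neutral_cong_left) auto
  have "S = (\<Sum>d\<in>D. \<Sum>x\<in>X. f x * (a d * of_bool (x \<in> L d)))"
    unfolding S_def power2_eq_square
    by (intro sum.cong) (simp_all add: a_eq sum_distrib_left mult_ac)
  also have "\<dots> = (\<Sum>x\<in>X. f x * g x)"
    by (subst sum.swap) (simp add: g_def sum_distrib_left)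
  finally have "S\<^sup>2 \<le> (\<Sum>x\<in>X. (f x)\<^sup>2) * (\<Sum>x\<in>X. (g x)\<^sup>2)"
    using Cauchy_Schwarz_ineq_sum[of f g X] by simp
  moreover have "(\<Sum>x\<in>X. (g x)\<^sup>2) \<le> 3 * N * S"
  proof -
    have "(\<Sum>x\<in>X. (g x)\<^sup>2) = (\<Sum>x\<in>X. \<Sum>d\<in>D. \<Sum>e\<in>D. a d * a e * of_bool (x \<in> L d \<inter> L e))"
      by (auto simp: g_def power2_eq_square sum_product intro!: sum.cong)
    also have "\<dots> = (\<Sum>d\<in>D. \<Sum>x\<in>X. \<Sum>e\<in>D. a d * a e * of_bool (x \<in> L d \<inter> L e))"
      by (rule sum.swap)
    also have "\<dots> = (\<Sum>d\<in>D. \<Sum>e\<in>D. \<Sum>x\<in>X. a d * a e * of_bool (x \<in> L d \<inter> L e))"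
      by (intro sum.cong refl sum.swap)
    also have "\<dots> = (\<Sum>d\<in>D. \<Sum>e\<in>D. a d * a e * real (card (L d \<inter> L e)))"
    proof (intro sum.cong refl)
      fix d e assume d: "d \<in> D" "e \<in> D"
      have "X \<inter> {x. x \<in> L d \<inter> L e} = L d \<inter> L e"
        using L_sub[OF d(1)] by auto
      then have "(\<Sum>x\<in>X. of_bool (x \<in> L d \<inter> L e)) = real (card (L d \<inter> L e))"
        using fin_X by (simp only: sum_of_bool_eq)
      then show "(\<Sum>x\<in>X. a d * a e * of_bool (x \<in> L d \<inter> L e)) = a d * a e * real (card (L d \<inter> L e))"
        by (simp flip: sum_distrib_left)
    qed
    \<comment> \<open>An intersection counts at most 1 off the diagonal and at most \<open>N\<close>
      on it; the first summand is kept on the diagonal so that the double sum factors.\<close>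
    also have "\<dots> \<le> (\<Sum>d\<in>D. \<Sum>e\<in>D. \<bar>a d\<bar> * \<bar>a e\<bar> + of_bool (d = e) * (N * (a d)\<^sup>2))"
    proof (intro sum_mono)
      fix d e assume d: "d \<in> D" "e \<in> D"
      show "a d * a e * real (card (L d \<inter> L e)) \<le> \<bar>a d\<bar> * \<bar>a e\<bar> + of_bool (d = e) * (N * (a d)\<^sup>2)"
      proof (cases "d = e")
        case True
        have "(a d)\<^sup>2 * real (card (L d)) \<le> (a d)\<^sup>2 * N"
          using card_L[OF d(1)] by (intro mult_left_mono) auto
        then show ?thesis using True by (simp add: power2_eq_square mult_ac add_increasing)
      next
        case False
        have "a d * a e * real (card (L d \<inter> L e)) \<le> \<bar>a d * a e\<bar> * real (card (L d \<inter> L e))"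
          by (intro mult_right_mono) auto
        also have "\<dots> \<le> \<bar>a d * a e\<bar> * 1"
          using card_inter[OF d False] by (intro mult_left_mono) auto
        finally show ?thesis using False by (simp add: abs_mult)
      qed
    qed
    also have "\<dots> = (\<Sum>d\<in>D. \<bar>a d\<bar>)\<^sup>2 + N * S"
    proof -
      have "(\<Sum>d\<in>D. \<Sum>e\<in>D. \<bar>a d\<bar> * \<bar>a e\<bar>) = (\<Sum>d\<in>D. \<bar>a d\<bar>)\<^sup>2"
        by (simp add: power2_eq_square sum_product)
      moreover have "(\<Sum>d\<in>D. \<Sum>e\<in>D. of_bool (d = e) * (N * (a d)\<^sup>2)) = N * S"
        using fin_D by (simp add: S_def sum_distrib_left)
      ultimately show ?thesis by (simp only: sum.distrib)
    qed
    \<comment> \<open>Cauchy-Schwarz against the constant 1; together with the diagonal this gives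
      \<open>2 * N * S + N * S\<close>.\<close>
    also have "(\<Sum>d\<in>D. \<bar>a d\<bar>)\<^sup>2 \<le> card D * S"
      using Cauchy_Schwarz_ineq_sum[of "\<lambda>d. 1" "\<lambda>d. \<bar>a d\<bar>" D] by (simp add: S_def)
    also have "card D * S \<le> 2 * N * S"
      using card_D S0 by (intro mult_right_mono) (simp_all flip: of_nat_mult)
    finally show ?thesis by (simp add: mult_ac)
  qed
  \<comment> \<open>Self-improvement: \<open>S\<close> is bounded through its own square, and one
    factor cancels unless \<open>S = 0\<close>.\<close>
  ultimately have "S * S \<le> (3 * N * (\<Sum>x\<in>X. (f x)\<^sup>2)) * S"
    using mult_left_mono[of "\<Sum>x\<in>X. (g x)\<^sup>2" "3 * N * S" "\<Sum>x\<in>X. (f x)\<^sup>2"]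
    by (simp add: power2_eq_square sum_nonneg mult_ac)
  then have "S \<le> 3 * N * (\<Sum>x\<in>X. (f x)\<^sup>2)"
    using S0 by (cases "S = 0") (auto simp: sum_nonneg)
  then show ?thesis by (simp add: S_def a_def)
qed

section \<open>Bounds for the line sums between all pairs of exponents\<close>

definition line_sum :: "('a \<Rightarrow> 'b::real_normed_vector) \<Rightarrow> 'd \<Rightarrow> real" where
  "line_sum f d = (\<Sum>x\<in>L d. norm (f x))"

lemma line_sum_nonneg: "0 \<le> line_sum f d"
  by (simp add: line_sum_def sum_nonneg)

lemma sum_line_le: "d \<in> D \<Longrightarrow> (\<And>x. x \<in> X \<Longrightarrow> 0 \<le> h x) \<Longrightarrow> (\<Sum>x\<in>L d. h x) \<le> (\<Sum>x\<in>X. h x :: real)"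
  using L_sub fin_X by (intro sum_mono2) auto

text \<open>Hoelder with exponent \<open>r/2 \<ge> 1\<close> on each line bounds the
  \<open>r\<close>-th power of a line sum by \<open>N^(r-2)\<close> times the squared line sum of
  \<open>|f|^(r/2)\<close>. The \<open>l^2\<close> bound contributes one further factor
  \<open>N\<close>, and the \<open>r\<close>-th root yields \<open>N^(1-1/r)\<close>. For
  \<open>u = \<infinity>\<close> it suffices that a line has at most \<open>N\<close>
  points.\<close>

lemma lp_norm_line_sum_le_diagonal:
  assumes "2 \<le> u"
  shows "lp_norm u D (line_sum f) \<le> 3 * real N powr (1 - real_of_ereal (1 / u)) * lp_norm u X f"
proof (cases u)
  case (real r)
  with assms have r: "2 \<le> r" by simp
  have *: "line_sum f d powr r \<le> N powr (r - 2) * (\<Sum>x\<in>L d. norm (f x) powr (r / 2))\<^sup>2"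
    if d: "d \<in> D" for d
  proof -
    let ?P = "\<Sum>x\<in>L d. norm (f x) powr (r / 2)"
    have "line_sum f d \<le> real (card (L d)) powr (1 - 1/(r/2)) * ?P powr (1/(r/2))"
      unfolding line_sum_def using r by (intro sum_le_card_powr_mult) auto
    also have "\<dots> \<le> real N powr (1 - 1/(r/2)) * ?P powr (1/(r/2))"
      using card_L[OF d] r by (intro mult_right_mono powr_mono2) auto
    finally have "line_sum f d powr r \<le> (real N powr (1 - 1/(r/2)) * ?P powr (1/(r/2))) powr r"
      using r by (intro powr_mono2) (auto simp: line_sum_nonneg)
    also have "\<dots> = N powr (r - 2) * ?P powr 2"
    proof -
      have "(1 - 1/(r/2)) * r = r - 2"
        using r by (simp add: field_simps)
      then show ?thesis
        using r by (simp add: powr_mult powr_powr sum_nonneg)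
    qed
    finally show ?thesis by (simp add: sum_nonneg)
  qed
  have "(\<Sum>d\<in>D. line_sum f d powr r) \<le> N powr (r - 2) * (\<Sum>d\<in>D. (\<Sum>x\<in>L d. norm (f x) powr (r / 2))\<^sup>2)"
    unfolding sum_distrib_left by (intro sum_mono *)
  also have "\<dots> \<le> N powr (r - 2) * (3 * N * (\<Sum>x\<in>X. (norm (f x) powr (r / 2))\<^sup>2))"
    by (intro mult_left_mono sum_line_sums_squared_le) auto
  also have "\<dots> = 3 * N powr (r - 1) * (\<Sum>x\<in>X. norm (f x) powr r)"
    using N_ge_1 powr_mult_base[of "real N" "r - 2"] by (simp add: powr_half_squared mult_ac)
  finally have "(\<Sum>d\<in>D. line_sum f d powr r) powr (1/r)
      \<le> (3 * N powr (r - 1) * (\<Sum>x\<in>X. norm (f x) powr r)) powr (1/r)"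
    using r by (intro powr_mono2) (auto simp: sum_nonneg)
  also have "\<dots> = 3 powr (1/r) * N powr (1 - 1/r) * (\<Sum>x\<in>X. norm (f x) powr r) powr (1/r)"
    using r by (simp add: powr_mult powr_powr sum_nonneg diff_divide_distrib)
  also have "\<dots> \<le> 3 * N powr (1 - 1/r) * (\<Sum>x\<in>X. norm (f x) powr r) powr (1/r)"
    using r powr_mono[of "1/r" 1 "3::real"] by (intro mult_right_mono) auto
  finally show ?thesis
    using r by (simp add: real lp_norm_ereal real_of_ereal_inverse line_sum_nonneg)
next
  case PInf
  have "line_sum f d \<le> N * lp_norm \<infinity> X f" if d: "d \<in> D" for d
  proof -
    have "line_sum f d \<le> of_nat (card (L d)) * lp_norm \<infinity> X f"
      unfolding line_sum_def using L_sub[OF d] fin_X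
      by (intro sum_bounded_above norm_le_lp_norm) auto
    also have "\<dots> \<le> N * lp_norm \<infinity> X f"
      using card_L[OF d] fin_X X_ne by (intro mult_right_mono) (auto simp: lp_norm_nonneg)
    finally show ?thesis .
  qed
  then have "lp_norm \<infinity> D (line_sum f) \<le> N * lp_norm \<infinity> X f"
    using fin_D D_ne by (simp add: lp_norm_def[of \<infinity> D] line_sum_nonneg)
  also have "\<dots> \<le> 3 * (N * lp_norm \<infinity> X f)"
    using lp_norm_nonneg[OF fin_X X_ne, of \<infinity> f] by simp
  finally show ?thesis by (simp add: PInf)
qed (use assms in auto)

text \<open>The target exponent \<open>w\<close> is conjugate to \<open>r\<close>. Hoelder splits
  \<open>|f|\<close> into powers of \<open>|f|^(r/2)\<close> and \<open>|f|^r\<close>; the sum of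
  the latter over a line is enlarged to the full sum \<open>E\<close>, so that only a square of line
  sums remains for the \<open>l^2\<close> bound.\<close>

lemma lp_norm_line_sum_le_dual:
  assumes r: "1 < r" "r < 2"
  shows "lp_norm (ereal (r / (r - 1))) D (line_sum f) \<le>
    3 * real N powr (1 - 1 / r) * lp_norm (ereal r) X f"
proof -
  define w where "w = r / (r - 1)"
  define E where "E = (\<Sum>x\<in>X. norm (f x) powr r)"
  have w: "2 < w" "1 / w = 1 - 1 / r" using r by (auto simp: w_def field_simps)
  have E: "0 \<le> E" by (simp add: E_def sum_nonneg)
  have *: "line_sum f d powr w \<le> (\<Sum>x\<in>L d. norm (f x) powr (r / 2))\<^sup>2 * E powr (w - 2)" if d: "d \<in> D" for d
  proof -
    let ?P = "\<Sum>x\<in>L d. norm (f x) powr (r / 2)"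
    \<comment> \<open>The total exponent of \<open>|f|\<close> is \<open>r - r/w\<close>, which is 1
      because \<open>r/w = r - 1\<close>.\<close>
    have "r / 2 * (2 / w) + r * (1 - 2 / w) = 1"
      using r by (simp add: w_def field_simps)
    then have "line_sum f d =
        (\<Sum>x\<in>L d. (norm (f x) powr (r / 2)) powr (2 / w) * (norm (f x) powr r) powr (1 - 2 / w))"
      unfolding line_sum_def by (intro sum.cong refl) (simp add: powr_powr flip: powr_add)
    also have "\<dots> \<le> ?P powr (2 / w) * (\<Sum>x\<in>L d. norm (f x) powr r) powr (1 - 2 / w)"
      using w by (intro sum_powr_mult_le) auto
    also have "\<dots> \<le> ?P powr (2 / w) * E powr (1 - 2 / w)"
      using w d unfolding E_def by (intro mult_left_mono powr_mono2 sum_line_le) (auto simp: sum_nonneg)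
    finally have "line_sum f d powr w \<le> (?P powr (2 / w) * E powr (1 - 2 / w)) powr w"
      using w by (intro powr_mono2) (auto simp: line_sum_nonneg)
    also have "\<dots> = ?P powr 2 * E powr (w - 2)"
      using w E by (simp add: powr_mult powr_powr sum_nonneg left_diff_distrib)
    finally show ?thesis by (simp add: sum_nonneg)
  qed
  have "(\<Sum>d\<in>D. line_sum f d powr w) \<le> (\<Sum>d\<in>D. (\<Sum>x\<in>L d. norm (f x) powr (r / 2))\<^sup>2) * E powr (w - 2)"
    unfolding sum_distrib_right by (intro sum_mono *)
  also have "\<dots> \<le> (3 * N * (\<Sum>x\<in>X. (norm (f x) powr (r / 2))\<^sup>2)) * E powr (w - 2)"
    by (intro mult_right_mono sum_line_sums_squared_le) auto
  also have "\<dots> = 3 * N * E powr (w - 1)"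
    using E powr_mult_base[of E "w - 2"] by (simp add: powr_half_squared E_def mult_ac)
  finally have "(\<Sum>d\<in>D. line_sum f d powr w) powr (1/w) \<le> (3 * N * E powr (w - 1)) powr (1/w)"
    using w(1) by (intro powr_mono2) (auto simp: sum_nonneg)
  also have "\<dots> = 3 powr (1/w) * N powr (1/w) * E powr (1 - 1/w)"
    using w(1) E by (simp add: powr_mult powr_powr diff_divide_distrib)
  also have "\<dots> \<le> 3 * N powr (1/w) * E powr (1 - 1/w)"
    using r w powr_mono[of "1/w" 1 "3::real"] by (intro mult_right_mono) auto
  finally show ?thesis
    by (simp add: lp_norm_ereal line_sum_nonneg w(2) E_def flip: w_def)
qed

text \<open>The endpoint \<open>u = 1\<close> of the dual range, with conjugate exponent infinity: a
  sum over one line is at most the sum over \<open>X\<close>.\<close>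

lemma lp_norm_line_sum_le_one:
  "lp_norm \<infinity> D (line_sum f) \<le> lp_norm 1 X f"
  using fin_D D_ne sum_line_le[of _ "\<lambda>x. norm (f x)"]
  by (simp add: lp_norm_def line_sum_nonneg sum_nonneg) (simp add: line_sum_def)

text \<open>Here \<open>w\<close> is \<open>u\<close> for \<open>u \<ge> 2\<close> and the conjugate
  exponent of \<open>u\<close> below 2. The value \<open>1/w = min x (1 - x)\<close> is the largest
  \<open>y\<close> for which \<open>1 - x\<close> is still the maximum of the three exponents, so
  this is the edge from which all other \<open>v\<close> are reached.\<close>

lemma lp_norm_line_sum_le_edge:
  assumes "1 \<le> u"
  defines "x \<equiv> real_of_ereal (1 / u)"
  obtains w where "1 \<le> w" "real_of_ereal (1 / w) = min x (1 - x)"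
    "lp_norm w D (line_sum f) \<le> 3 * real N powr (1 - x) * lp_norm u X f"
proof -
  consider "2 \<le> u" | r where "u = ereal r" "1 < r" "r < 2" | "u = 1"
  proof (cases u)
    case (real r)
    then show ?thesis
      using that assms(1) by (cases "2 \<le> r"; cases "r = 1"; simp add: one_ereal_def)
  qed (use that assms(1) in auto)
  then show ?thesis
  proof cases
    case 1
    then have "x \<le> 1 - x" unfolding x_def by (cases u) (auto simp: real_of_ereal_inverse)
    then show ?thesis using 1 assms
      by (intro that[of u]) (auto intro: lp_norm_line_sum_le_diagonal)
  next
    case 2
    then show ?thesis
      using lp_norm_line_sum_le_dual[of r f]
      by (intro that[of "ereal (r / (r - 1))"])
        (auto simp: x_def real_of_ereal_inverse min_def field_simps)
  next
    case 3
    have "lp_norm 1 X f \<le> 3 * lp_norm 1 X f"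
      using lp_norm_nonneg[OF fin_X X_ne, of 1 f] by simp
    then show ?thesis
      using 3 lp_norm_line_sum_le_one[of f] N_ge_1 by (intro that[of \<infinity>]) (auto simp: x_def)
  qed
qed

text \<open>Above the edge exponent \<open>w\<close> the norms are nested and nothing is lost. Below
  it, Hoelder over the directions costs \<open>card D\<close> to the power \<open>1/v - 1/w\<close>,
  which produces the other two exponents.\<close>

lemma lp_norm_line_sum_le:
  assumes "1 \<le> u" "1 \<le> v"
  defines "x \<equiv> real_of_ereal (1 / u)" and "y \<equiv> real_of_ereal (1 / v)"
  shows "lp_norm v D (line_sum f) \<le> 6 * real N powr (Max {y, 1 - x, 1 + y - 2 * x}) * lp_norm u X f"
    (is "_ \<le> 6 * _ powr ?A * _")
proof -
  obtain w where w: "1 \<le> w" "real_of_ereal (1 / w) = min x (1 - x)"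
    and le: "lp_norm w D (line_sum f) \<le> 3 * real N powr (1 - x) * lp_norm u X f"
    using lp_norm_line_sum_le_edge[OF assms(1), of f] unfolding x_def by blast
  have U: "0 \<le> lp_norm u X f" using lp_norm_nonneg[OF fin_X X_ne] .
  show ?thesis
  proof (cases "w \<le> v")
    case True
    have "lp_norm v D (line_sum f) \<le> 3 * real N powr (1 - x) * lp_norm u X f"
      using lp_norm_antimono[OF fin_D D_ne w(1) True] le by (rule order_trans)
    also have "\<dots> \<le> 6 * real N powr ?A * lp_norm u X f"
      using N_ge_1 U by (intro mult_mono powr_mono) auto
    finally show ?thesis .
  next
    case False
    define z where "z = y - min x (1 - x)"
    \<comment> \<open>As \<open>v < w\<close>, the reciprocals satisfy \<open>1/w \<le> y\<close>;
      the bound \<open>z \<le> 1\<close> later keeps \<open>2 powr z\<close> below 2, whence the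
      constant \<open>6 = 2 * 3\<close>.\<close>
    have "0 \<le> y \<and> y \<le> 1" "0 \<le> min x (1 - x)" "min x (1 - x) \<le> y"
      using assms(2) w False unfolding y_def w(2)[symmetric]
      by (cases v; cases w; auto simp: real_of_ereal_inverse field_simps)+
    then have z: "0 \<le> z" "z \<le> 1" by (auto simp: z_def)
    have "real (card D) powr z \<le> (2 * real N) powr z"
      using z card_D by (intro powr_mono2) (simp_all flip: of_nat_mult)
    also have "\<dots> = 2 powr z * real N powr z" by (simp add: powr_mult)
    also have "\<dots> \<le> 2 * real N powr z"
      using z powr_mono[of z 1 "2::real"] by (intro mult_right_mono) auto
    finally have card: "real (card D) powr z \<le> 2 * real N powr z" .
    have "lp_norm v D (line_sum f) \<le> real (card D) powr z * lp_norm w D (line_sum f)"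
      using lp_norm_le_card_powr_mult[OF fin_D D_ne assms(2), of w "line_sum f"] False w(2)
      by (simp add: z_def y_def)
    also have "\<dots> \<le> (2 * real N powr z) * (3 * real N powr (1 - x) * lp_norm u X f)"
      using card le lp_norm_nonneg[OF fin_D D_ne] by (intro mult_mono) auto
    also have "\<dots> = 6 * real N powr (z + (1 - x)) * lp_norm u X f"
      by (simp add: powr_add)
    \<comment> \<open>The exponent \<open>z + (1 - x)\<close> equals \<open>1 + y - 2 * x\<close> if
      the minimum is \<open>x\<close>, and \<open>y\<close> if it is \<open>1 - x\<close>.\<close>
    also have "\<dots> \<le> 6 * real N powr ?A * lp_norm u X f"
      using N_ge_1 U by (intro mult_mono powr_mono) (auto simp: z_def min_def)
    finally show ?thesis .
  qed
qed

end

section \<open>Horizontal lines over a finite field\<close>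

lemma carrier_heisenberg_group:
  "carrier (heisenberg_group R) = carrier R \<times> carrier R \<times> carrier R"
  by (simp add: heisenberg_group_def)

text \<open>The term \<open>t \<oplus> \<zero>\<close> stays unsimplified because no ring laws are
  available for \<open>R\<close> at this point.\<close>

lemma horizontal_line_image:
  "horizontal_line R (x, y, t) (a, b) =
    (\<lambda>s. (x \<oplus>\<^bsub>R\<^esub> s \<otimes>\<^bsub>R\<^esub> a, y \<oplus>\<^bsub>R\<^esub> s \<otimes>\<^bsub>R\<^esub> b, (t \<oplus>\<^bsub>R\<^esub> \<zero>\<^bsub>R\<^esub>) \<oplus>\<^bsub>R\<^esub>
      ((x \<otimes>\<^bsub>R\<^esub> (s \<otimes>\<^bsub>R\<^esub> b)) \<ominus>\<^bsub>R\<^esub> (y \<otimes>\<^bsub>R\<^esub> (s \<otimes>\<^bsub>R\<^esub> a))))) ` carrier R"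
  by (auto simp: horizontal_line_def heisenberg_group_def)

locale finite_field = field R for R (structure) +
  assumes finite_carrier: "finite (carrier R)"
begin

section \<open>Directions and the size of the projective line\<close>

lemma nonzero_vectors_iff:
  "(a, b) \<in> nonzero_vectors R \<longleftrightarrow> a \<in> carrier R \<and> b \<in> carrier R \<and> (a \<noteq> \<zero> \<or> b \<noteq> \<zero>)"
  by (auto simp: nonzero_vectors_def)

lemma proportionalI:
  assumes "v \<in> nonzero_vectors R" "w \<in> nonzero_vectors R" "c \<in> carrier R" "c \<noteq> \<zero>"
    "w = (c \<otimes> fst v, c \<otimes> snd v)"
  shows "(v, w) \<in> proportional R"
  using assms by (auto simp: proportional_def)

lemma proportionalE:
  assumes "(v, w) \<in> proportional R"
  obtains c where "v \<in> nonzero_vectors R" "w \<in> nonzero_vectors R" "c \<in> carrier R" "c \<noteq> \<zero>"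
    "w = (c \<otimes> fst v, c \<otimes> snd v)"
  using assms unfolding proportional_def by blast

lemma equiv_proportional: "equiv (nonzero_vectors R) (proportional R)"
proof (rule equivI)
  show "proportional R \<subseteq> nonzero_vectors R \<times> nonzero_vectors R"
    by (auto simp: proportional_def)
  show "refl_on (nonzero_vectors R) (proportional R)"
    by (rule refl_onI) (auto intro!: proportionalI[where c = \<one>] simp: nonzero_vectors_def)
  show "sym (proportional R)"
  proof (rule symI)
    fix v w assume "(v, w) \<in> proportional R"
    then obtain c where c: "v \<in> nonzero_vectors R" "w \<in> nonzero_vectors R"
      "c \<in> carrier R" "c \<noteq> \<zero>" "w = (c \<otimes> fst v, c \<otimes> snd v)"
      by (rule proportionalE)
    then have inv: "inv c \<in> carrier R" "inv c \<otimes> c = \<one>" "inv c \<noteq> \<zero>"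
      using field_Units by (auto simp: nonzero_imp_inverse_nonzero)
    have "inv c \<otimes> (c \<otimes> z) = z" if "z \<in> carrier R" for z
      using that c inv by (simp flip: m_assoc)
    moreover have "fst v \<in> carrier R" "snd v \<in> carrier R"
      using c(1) by (auto simp: nonzero_vectors_def)
    ultimately have "v = (inv c \<otimes> fst w, inv c \<otimes> snd w)"
      unfolding c(5) by simp
    then show "(w, v) \<in> proportional R"
      by (rule proportionalI[OF c(2,1) inv(1,3)])
  qed
  show "trans (proportional R)"
  proof (rule transI)
    fix v w z assume "(v, w) \<in> proportional R" "(w, z) \<in> proportional R"
    then obtain c c' where c: "v \<in> nonzero_vectors R" "z \<in> nonzero_vectors R"
      "c \<in> carrier R" "c \<noteq> \<zero>" "c' \<in> carrier R" "c' \<noteq> \<zero>"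
      "w = (c \<otimes> fst v, c \<otimes> snd v)" "z = (c' \<otimes> fst w, c' \<otimes> snd w)"
      by (elim proportionalE)
    have "fst v \<in> carrier R" "snd v \<in> carrier R"
      using c(1) by (auto simp: nonzero_vectors_def)
    then have "z = (c' \<otimes> c \<otimes> fst v, c' \<otimes> c \<otimes> snd v)"
      unfolding c(7,8) using c(3,5) by (simp add: m_assoc)
    then show "(v, z) \<in> proportional R"
      using c(1-6) by (intro proportionalI[of _ _ "c' \<otimes> c"]) (simp_all add: integral_iff)
  qed
qed

text \<open>The same choice of representative as in \<open>kakeya_maximal\<close>, so that the two
  match syntactically.\<close>

abbreviation rep :: "('a \<times> 'a) set \<Rightarrow> 'a \<times> 'a" where
  "rep d \<equiv> SOME v. v \<in> d"

lemma rep_mem: "d \<in> proj_line R \<Longrightarrow> rep d \<in> d"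
  using in_quotient_imp_non_empty[OF equiv_proportional] unfolding proj_line_def by (metis some_in_eq)

lemma rep_nonzero: "d \<in> proj_line R \<Longrightarrow> rep d \<in> nonzero_vectors R"
  using rep_mem in_quotient_imp_subset[OF equiv_proportional] unfolding proj_line_def by blast

lemma rep_not_proportional:
  "d \<in> proj_line R \<Longrightarrow> e \<in> proj_line R \<Longrightarrow> d \<noteq> e \<Longrightarrow> (rep d, rep e) \<notin> proportional R"
  using quotient_eq_iff[OF equiv_proportional] rep_mem unfolding proj_line_def by blast

lemma finite_nonzero_vectors: "finite (nonzero_vectors R)"
  using finite_carrier by (simp add: nonzero_vectors_def)

lemma finite_proj_line: "finite (proj_line R)"
  unfolding proj_line_def using finite_nonzero_vectors
  by (intro finite_quotient) (auto simp: proportional_def)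

lemma card_carrier_pos: "0 < card (carrier R)"
  using finite_carrier zero_closed by (auto simp: card_gt_0_iff)

text \<open>Dividing by the first nonzero coordinate shows that the classes of
  \<open>(\<zero>, \<one>)\<close> and of the vectors \<open>(\<one>, b)\<close> exhaust the line:
  at most \<open>q + 1\<close> classes.\<close>

lemma card_proj_line_le: "card (proj_line R) \<le> 2 * card (carrier R)"
proof -
  have "proj_line R \<subseteq> insert (proportional R `` {(\<zero>, \<one>)})
      ((\<lambda>b. proportional R `` {(\<one>, b)}) ` carrier R)"
  proof
    fix d assume "d \<in> proj_line R"
    then obtain a b where d: "d = proportional R `` {(a, b)}" and ab: "(a, b) \<in> nonzero_vectors R"
      unfolding proj_line_def by (metis prod.exhaust quotientE)
    have carr: "a \<in> carrier R" "b \<in> carrier R" using ab by (auto simp: nonzero_vectors_iff)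
    show "d \<in> insert (proportional R `` {(\<zero>, \<one>)}) ((\<lambda>b. proportional R `` {(\<one>, b)}) ` carrier R)"
    proof (cases "a = \<zero>")
      case True
      then have "((\<zero>, \<one>), (a, b)) \<in> proportional R"
        using ab carr by (intro proportionalI[of _ _ b]) (auto simp: nonzero_vectors_iff)
      then show ?thesis using equiv_class_eq[OF equiv_proportional] d by blast
    next
      case False
      then have inv: "inv a \<in> carrier R" "a \<otimes> inv a = \<one>" using carr field_Units by auto
      then have "a \<otimes> (inv a \<otimes> b) = b" using carr by (simp flip: m_assoc)
      then have "((\<one>, inv a \<otimes> b), (a, b)) \<in> proportional R"
        using ab carr inv False by (intro proportionalI[of _ _ a]) (auto simp: nonzero_vectors_iff)
      then show ?thesis using equiv_class_eq[OF equiv_proportional] d inv carr by blast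
    qed
  qed
  then have "card (proj_line R) \<le> card (insert (proportional R `` {(\<zero>, \<one>)})
      ((\<lambda>b. proportional R `` {(\<one>, b)}) ` carrier R))"
    using finite_carrier by (intro card_mono) auto
  also have "\<dots> \<le> Suc (card (carrier R))"
    using finite_carrier card_image_le[OF finite_carrier, of "\<lambda>b. proportional R `` {(\<one>, b)}"]
    by (simp add: card_insert_if)
  finally show ?thesis using card_carrier_pos by simp
qed

text \<open>The vectors \<open>(\<one>, b)\<close> are pairwise inequivalent, since the first
  coordinate forces the scalar to be \<open>\<one>\<close>.\<close>

lemma card_proj_line_ge: "card (carrier R) \<le> card (proj_line R)"
proof (rule card_inj_on_le)
  show "inj_on (\<lambda>b. proportional R `` {(\<one>, b)}) (carrier R)"
  proof (rule inj_onI)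
    fix b b' assume b: "b \<in> carrier R" "b' \<in> carrier R"
      "proportional R `` {(\<one>, b)} = proportional R `` {(\<one>, b')}"
    then have "((\<one>, b), (\<one>, b')) \<in> proportional R"
      using eq_equiv_class_iff[OF equiv_proportional] by (auto simp: nonzero_vectors_iff)
    then show "b = b'" using b by (auto simp: proportional_def)
  qed
  show "(\<lambda>b. proportional R `` {(\<one>, b)}) ` carrier R \<subseteq> proj_line R"
    unfolding proj_line_def by (auto intro!: quotientI simp: nonzero_vectors_iff)
qed (rule finite_proj_line)

section \<open>Horizontal lines and their intersections\<close>

lemma horizontal_line_subset:
  assumes "p \<in> carrier (heisenberg_group R)" "v \<in> nonzero_vectors R"
  shows "horizontal_line R p v \<subseteq> carrier (heisenberg_group R)"
  using assms
  by (cases p; cases v) (auto simp: horizontal_line_image nonzero_vectors_iff carrier_heisenberg_group)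

lemma card_horizontal_line_le: "card (horizontal_line R p v) \<le> card (carrier R)"
  by (cases p; cases v) (auto simp: horizontal_line_image intro!: card_image_le finite_carrier)

lemma finite_horizontal_line: "finite (horizontal_line R p v)"
  by (cases p; cases v) (auto simp: horizontal_line_image finite_carrier)

text \<open>Subtracting the equations of two common points removes the base points; applied once to
  each of the two horizontal coordinates.\<close>

lemma difference_eq:
  assumes carr: "x \<in> carrier R" "x' \<in> carrier R" "a \<in> carrier R" "a' \<in> carrier R"
    "s \<in> carrier R" "s' \<in> carrier R" "r \<in> carrier R" "r' \<in> carrier R"
    and "x \<oplus> s \<otimes> a = x' \<oplus> r \<otimes> a'" "x \<oplus> s' \<otimes> a = x' \<oplus> r' \<otimes> a'"
  shows "(s \<ominus> s') \<otimes> a = (r \<ominus> r') \<otimes> a'"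
proof -
  have "(s \<ominus> s') \<otimes> a = (x \<oplus> s \<otimes> a) \<ominus> (x \<oplus> s' \<otimes> a)" using carr by algebra
  also have "\<dots> = (x' \<oplus> r \<otimes> a') \<ominus> (x' \<oplus> r' \<otimes> a')" using assms by simp
  also have "\<dots> = (r \<ominus> r') \<otimes> a'" using carr by algebra
  finally show ?thesis .
qed

text \<open>The projections to the first two coordinates decide: the difference of two common points
  would be a nonzero multiple of both direction vectors, which would make them proportional.\<close>

lemma card_horizontal_line_Int_le_1:
  assumes p: "p \<in> carrier (heisenberg_group R)" "p' \<in> carrier (heisenberg_group R)"
    and vw: "v \<in> nonzero_vectors R" "w \<in> nonzero_vectors R" "(v, w) \<notin> proportional R"
  shows "card (horizontal_line R p v \<inter> horizontal_line R p' w) \<le> 1"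
proof -
  obtain x y t x' y' t' a b a' b' where eqs:
      "p = (x, y, t)" "p' = (x', y', t')" "v = (a, b)" "w = (a', b')"
    by (cases p; cases p'; cases v; cases w)
  have carr: "x \<in> carrier R" "y \<in> carrier R" "x' \<in> carrier R" "y' \<in> carrier R"
    "a \<in> carrier R" "b \<in> carrier R" "a' \<in> carrier R" "b' \<in> carrier R"
    using p vw(1,2) by (auto simp: eqs carrier_heisenberg_group nonzero_vectors_iff)
  have "z1 = z2" if z: "z1 \<in> horizontal_line R p v \<inter> horizontal_line R p' w"
      "z2 \<in> horizontal_line R p v \<inter> horizontal_line R p' w" for z1 z2
  proof (rule ccontr)
    assume ne: "z1 \<noteq> z2"
    \<comment> \<open>A point of a line is determined by its parameter, so distinct points give
      \<open>s \<noteq> s'\<close>.\<close>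
    obtain s s' r r' where s: "s \<in> carrier R" "s' \<in> carrier R" "r \<in> carrier R" "r' \<in> carrier R"
      and e: "x \<oplus> s \<otimes> a = x' \<oplus> r \<otimes> a'" "x \<oplus> s' \<otimes> a = x' \<oplus> r' \<otimes> a'"
        "y \<oplus> s \<otimes> b = y' \<oplus> r \<otimes> b'" "y \<oplus> s' \<otimes> b = y' \<oplus> r' \<otimes> b'" and "s \<noteq> s'"
      using z ne unfolding eqs horizontal_line_image by auto
    define \<sigma> \<rho> where "\<sigma> = s \<ominus> s'" and "\<rho> = r \<ominus> r'"
    have \<sigma>: "\<sigma> \<in> carrier R" "\<rho> \<in> carrier R" "\<sigma> \<noteq> \<zero>"
      using s \<open>s \<noteq> s'\<close> by (auto simp: \<sigma>_def \<rho>_def r_right_minus_eq)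
    have a: "\<sigma> \<otimes> a = \<rho> \<otimes> a'"
      unfolding \<sigma>_def \<rho>_def by (rule difference_eq[OF carr(1,3,5,7) s e(1,2)])
    have b: "\<sigma> \<otimes> b = \<rho> \<otimes> b'"
      unfolding \<sigma>_def \<rho>_def by (rule difference_eq[OF carr(2,4,6,8) s e(3,4)])
    \<comment> \<open>Otherwise the nonzero \<open>\<sigma>\<close> would annihilate both
      coordinates of \<open>v\<close>.\<close>
    have "\<rho> \<noteq> \<zero>"
      using a b \<sigma> carr vw(1) by (auto simp: eqs nonzero_vectors_iff integral_iff)
    then have inv: "inv \<rho> \<in> carrier R" "inv \<rho> \<otimes> \<rho> = \<one>" "inv \<rho> \<noteq> \<zero>"
      using \<sigma> field_Units by (auto simp: nonzero_imp_inverse_nonzero)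
    have cancel: "inv \<rho> \<otimes> (\<rho> \<otimes> z) = z" if "z \<in> carrier R" for z
      using that inv(1,2) \<sigma>(2) by (simp flip: m_assoc)
    have "w = (inv \<rho> \<otimes> \<sigma> \<otimes> fst v, inv \<rho> \<otimes> \<sigma> \<otimes> snd v)"
      using inv(1) \<sigma>(1) carr by (simp add: eqs m_assoc a b cancel)
    then have "(v, w) \<in> proportional R"
      using inv \<sigma> by (intro proportionalI[OF vw(1,2)]) (simp_all add: integral_iff)
    then show False using vw(3) by simp
  qed
  then show ?thesis
    by (simp add: card_le_Suc0_iff_eq finite_horizontal_line)
qed

section \<open>Upper bound for the maximal operator\<close>

lemma finite_heisenberg_group: "finite (carrier (heisenberg_group R))"
  using finite_carrier by (simp add: carrier_heisenberg_group)

lemma origin_in_heisenberg_group: "(\<zero>, \<zero>, \<zero>) \<in> carrier (heisenberg_group R)"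
  by (simp add: carrier_heisenberg_group)

text \<open>Fixing a maximising base point for each direction linearises the operator: it becomes
  the \<open>line_sum\<close> of one line per direction.\<close>

lemma kakeya_maximal_bound:
  assumes "1 \<le> u" "1 \<le> v"
  defines "x \<equiv> real_of_ereal (1 / u)" and "y \<equiv> real_of_ereal (1 / v)"
  shows "lp_norm v (proj_line R) (kakeya_maximal R F) \<le>
    6 * real (card (carrier R)) powr (Max {y, 1 - x, 1 + y - 2 * x}) *
      lp_norm u (carrier (heisenberg_group R)) F"
proof -
  let ?H = "carrier (heisenberg_group R)"
  have "\<exists>p\<in>?H. kakeya_maximal R F d = (\<Sum>x\<in>horizontal_line R p (rep d). cmod (F x))" for d
  proof -
    have "kakeya_maximal R F d \<in> (\<lambda>p. \<Sum>x\<in>horizontal_line R p (rep d). cmod (F x)) ` ?H"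
      unfolding kakeya_maximal_def using finite_heisenberg_group origin_in_heisenberg_group
      by (intro Max_in) auto
    then show ?thesis by auto
  qed
  \<comment> \<open>\<open>P\<close> is chosen for every \<open>d\<close>, not just for directions,
    so that the equality with \<open>line_sum\<close> holds as one of functions.\<close>
  then obtain P where P: "P d \<in> ?H"
      "kakeya_maximal R F d = (\<Sum>x\<in>horizontal_line R (P d) (rep d). cmod (F x))" for d
    by metis
  interpret line_family "proj_line R" ?H "\<lambda>d. horizontal_line R (P d) (rep d)" "card (carrier R)"
  proof unfold_locales
    show "proj_line R \<noteq> {}"
      using card_proj_line_ge card_carrier_pos by auto
    show "?H \<noteq> {}" using origin_in_heisenberg_group by blast
    show "card (proj_line R) \<le> 2 * card (carrier R)" by (rule card_proj_line_le)
    fix d assume d: "d \<in> proj_line R"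
    show "horizontal_line R (P d) (rep d) \<subseteq> ?H"
      by (rule horizontal_line_subset[OF P(1) rep_nonzero[OF d]])
    show "card (horizontal_line R (P d) (rep d)) \<le> card (carrier R)"
      by (rule card_horizontal_line_le)
    fix e assume "e \<in> proj_line R" "d \<noteq> e"
    then show "card (horizontal_line R (P d) (rep d) \<inter> horizontal_line R (P e) (rep e)) \<le> 1"
      using d by (intro card_horizontal_line_Int_le_1 P(1) rep_nonzero rep_not_proportional)
  qed (simp_all add: finite_proj_line finite_heisenberg_group)
  have "kakeya_maximal R F = line_sum F" by (rule ext) (simp add: P(2) line_sum_def)
  then show ?thesis
    using lp_norm_line_sum_le[OF assms(1,2), of F] by (simp add: x_def y_def)
qed

section \<open>Lower bounds from lines through the origin\<close>

lemma horizontal_line_origin: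
  assumes "v \<in> nonzero_vectors R"
  shows "horizontal_line R (\<zero>, \<zero>, \<zero>) v = (\<lambda>s. (s \<otimes> fst v, s \<otimes> snd v, \<zero>)) ` carrier R"
  \<comment> \<open>At the origin the twisting term of the group law vanishes, so the line stays in
    the plane \<open>t = 0\<close>.\<close>
  using assms by (cases v) (auto simp: horizontal_line_image nonzero_vectors_iff minus_eq intro!: image_cong)

lemma card_horizontal_line_origin:
  assumes "v \<in> nonzero_vectors R"
  shows "card (horizontal_line R (\<zero>, \<zero>, \<zero>) v) = card (carrier R)"
proof -
  have "inj_on (\<lambda>s. (s \<otimes> fst v, s \<otimes> snd v, \<zero>)) (carrier R)"
    using assms by (intro inj_onI) (cases v, auto simp: nonzero_vectors_iff m_rcancel)
  then show ?thesis by (simp add: horizontal_line_origin[OF assms] card_image)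
qed

lemma kakeya_maximal_of_bool_ge:
  assumes "S \<subseteq> carrier (heisenberg_group R)"
  shows "real (card (horizontal_line R (\<zero>, \<zero>, \<zero>) (rep d) \<inter> S)) \<le>
    kakeya_maximal R (\<lambda>x. of_bool (x \<in> S)) d"
proof -
  have 1: "cmod (of_bool P) = of_bool P" for P by (cases P) auto
  have "real (card (horizontal_line R (\<zero>, \<zero>, \<zero>) (rep d) \<inter> S))
      = (\<Sum>x\<in>horizontal_line R (\<zero>, \<zero>, \<zero>) (rep d). cmod (of_bool (x \<in> S)))"
    using finite_horizontal_line by (simp add: 1)
  also have "\<dots> \<le> kakeya_maximal R (\<lambda>x. of_bool (x \<in> S)) d"
    unfolding kakeya_maximal_def using finite_heisenberg_group origin_in_heisenberg_group
    by (intro Max_ge) auto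
  finally show ?thesis .
qed

text \<open>Tests the bound on the indicator of \<open>S\<close>: in the directions \<open>E\<close>
  the maximal function is at least \<open>c\<close>, by the line through the origin.
  \<open>K\<close> stands for the whole factor \<open>C * q powr B\<close>.\<close>

lemma test_set_lower_bound:
  assumes uv: "1 \<le> u" "1 \<le> v"
    and bound: "lp_norm v (proj_line R) (kakeya_maximal R (\<lambda>x. of_bool (x \<in> S)))
      \<le> K * lp_norm u (carrier (heisenberg_group R)) (\<lambda>x. of_bool (x \<in> S) :: complex)"
    and S: "S \<subseteq> carrier (heisenberg_group R)" "S \<noteq> {}"
    and E: "E \<subseteq> proj_line R" "E \<noteq> {}"
    and c: "\<And>d. d \<in> E \<Longrightarrow> c \<le> card (horizontal_line R (\<zero>, \<zero>, \<zero>) (rep d) \<inter> S)"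
  shows "real c * real (card E) powr real_of_ereal (1 / v) \<le>
    K * real (card S) powr real_of_ereal (1 / u)"
proof -
  have "real c \<le> norm (kakeya_maximal R (\<lambda>x. of_bool (x \<in> S)) d)" if "d \<in> E" for d
  proof -
    have "real c \<le> real (card (horizontal_line R (\<zero>, \<zero>, \<zero>) (rep d) \<inter> S))" using c[OF that] by simp
    also have "\<dots> \<le> kakeya_maximal R (\<lambda>x. of_bool (x \<in> S)) d"
      using S(1) by (rule kakeya_maximal_of_bool_ge)
    finally show ?thesis by simp
  qed
  then have "real c * real (card E) powr real_of_ereal (1 / v) \<le>
      lp_norm v (proj_line R) (kakeya_maximal R (\<lambda>x. of_bool (x \<in> S)))"
    using E uv by (intro lp_norm_ge finite_proj_line) auto
  also note bound
  also have "lp_norm u (carrier (heisenberg_group R)) (\<lambda>x. of_bool (x \<in> S) :: complex)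
      = real (card S) powr real_of_ereal (1 / u)"
    using S uv finite_heisenberg_group by (intro lp_norm_of_bool) auto
  finally show ?thesis .
qed

lemma kakeya_maximal_lower_bounds:
  assumes uv: "1 \<le> u" "1 \<le> v"
    and bound: "\<And>F. lp_norm v (proj_line R) (kakeya_maximal R F)
      \<le> K * lp_norm u (carrier (heisenberg_group R)) F"
  defines "x \<equiv> real_of_ereal (1 / u)" and "y \<equiv> real_of_ereal (1 / v)"
    and "q \<equiv> real (card (carrier R))"
  shows "q powr y \<le> K" and "q powr (1 - x) \<le> K" and "q powr (1 + y - 2 * x) \<le> K"
proof -
  have q: "0 < q" using card_carrier_pos by (simp add: q_def)
  have y: "0 \<le> y" using uv by (cases v) (auto simp: y_def real_of_ereal_inverse)
  have ne: "proj_line R \<noteq> {}" using card_proj_line_ge card_carrier_pos by auto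
  have qD: "q powr y \<le> real (card (proj_line R)) powr y"
    using card_proj_line_ge y q by (intro powr_mono2) (auto simp: q_def)
  note test = test_set_lower_bound[OF uv bound, folded x_def y_def]
  \<comment> \<open>One point of mass in every direction: \<open>c = 1\<close>, all directions,
    \<open>card S = 1\<close>.\<close>
  have "real 1 * real (card (proj_line R)) powr y \<le> K * real (card {(\<zero>, \<zero>, \<zero>)}) powr x"
  proof (rule test)
    fix d assume "d \<in> proj_line R"
    then have "(\<zero>, \<zero>, \<zero>) \<in> horizontal_line R (\<zero>, \<zero>, \<zero>) (rep d)"
      using rep_nonzero[of d]
      by (cases "rep d") (auto simp: horizontal_line_origin nonzero_vectors_iff intro!: image_eqI[of _ _ \<zero>])
    then show "1 \<le> card (horizontal_line R (\<zero>, \<zero>, \<zero>) (rep d) \<inter> {(\<zero>, \<zero>, \<zero>)})" by simp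
  qed (use ne origin_in_heisenberg_group in auto)
  then show "q powr y \<le> K" using qD by simp
  obtain d where d: "d \<in> proj_line R" using ne by blast
  let ?l = "horizontal_line R (\<zero>, \<zero>, \<zero>) (rep d)"
  have card_l: "card ?l = card (carrier R)" using card_horizontal_line_origin rep_nonzero d by blast
  \<comment> \<open>One full line in its own direction: \<open>q \<le> K * q powr x\<close>.\<close>
  have "real (card (carrier R)) * real (card {d}) powr y \<le> K * real (card ?l) powr x"
  proof (rule test)
    show "?l \<noteq> {}" using card_l card_carrier_pos by auto
  qed (use d horizontal_line_subset[OF origin_in_heisenberg_group rep_nonzero[OF d]] in
      \<open>auto simp: card_l\<close>)
  then show "q powr (1 - x) \<le> K"
    using q by (simp add: card_l powr_diff divide_le_eq flip: q_def)
  let ?S = "carrier R \<times> carrier R \<times> {\<zero>}"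
  \<comment> \<open>The plane has \<open>q * q\<close> points and contains a full line in each
    direction.\<close>
  have "real (card (carrier R)) * real (card (proj_line R)) powr y \<le> K * real (card ?S) powr x"
  proof (rule test)
    fix e assume e: "e \<in> proj_line R"
    have "horizontal_line R (\<zero>, \<zero>, \<zero>) (rep e) \<subseteq> ?S"
      using rep_nonzero[OF e] by (cases "rep e") (auto simp: horizontal_line_origin nonzero_vectors_iff)
    then show "card (carrier R) \<le> card (horizontal_line R (\<zero>, \<zero>, \<zero>) (rep e) \<inter> ?S)"
      using card_horizontal_line_origin[OF rep_nonzero[OF e]] by (simp add: Int_absorb2)
  qed (use ne in \<open>auto simp: carrier_heisenberg_group\<close>)
  then have "q * real (card (proj_line R)) powr y \<le> K * (q * q) powr x"
    by (simp add: card_cartesian_product q_def)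
  also have "(q * q) powr x = q powr (2 * x)"
    by (simp add: powr_mult flip: powr_add)
  finally have "q * q powr y \<le> K * q powr (2 * x)"
    using mult_left_mono[OF qD, of q] q by linarith
  then show "q powr (1 + y - 2 * x) \<le> K"
    using q by (simp add: powr_diff powr_add divide_le_eq)
qed

end

section \<open>The growth exponent\<close>

text \<open>If \<open>a > b\<close>, then \<open>p powr (a - b)\<close> would be bounded by
  \<open>C\<close>, although there are arbitrarily large primes.\<close>

lemma exponent_le_if_powr_bound_on_primes:
  fixes a b C :: real
  assumes bound: "\<And>p. prime p \<Longrightarrow> odd p \<Longrightarrow> real p powr a \<le> C * real p powr b"
  shows "a \<le> b"
proof (rule ccontr)
  assume "\<not> a \<le> b"
  then have ab: "a - b > 0" by simp
  \<comment> \<open>The entry 2 makes a prime above \<open>M\<close> odd; the other entry makes its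
    power \<open>a - b\<close> exceed \<open>\<bar>C\<bar>\<close>.\<close>
  define M where "M = max 2 (nat \<lceil>\<bar>C\<bar> powr (1 / (a - b))\<rceil>)"
  obtain p where p: "prime p" "p > M" using bigger_prime by blast
  then have p': "odd p" "0 < real p" "\<bar>C\<bar> powr (1 / (a - b)) < p"
    using prime_odd_nat[of p] by (auto simp: M_def) linarith
  have "\<bar>C\<bar> = (\<bar>C\<bar> powr (1 / (a - b))) powr (a - b)" using ab by (simp add: powr_powr)
  also have "\<dots> < p powr (a - b)" using p' ab by (intro powr_less_mono2) auto
  also have "\<dots> = p powr a / p powr b" by (rule powr_diff)
  also have "\<dots> \<le> C" using bound[OF p(1) p'(1)] p' by (simp add: divide_le_eq)
  finally show False by simp
qed

lemma kakeya_bound_max_exponent: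
  assumes "1 \<le> u" "1 \<le> v"
  defines "x \<equiv> real_of_ereal (1 / u)" and "y \<equiv> real_of_ereal (1 / v)"
  shows "kakeya_bound u v (Max {y, 1 - x, 1 + y - 2 * x})"
  unfolding kakeya_bound_def
proof (rule exI[of _ 6], intro conjI allI impI)
  fix q :: nat and R :: "int ring" and F :: "int \<times> int \<times> int \<Rightarrow> complex"
  assume q: "odd q \<and> primepow q" and R: "field R \<and> card (carrier R) = q"
  \<comment> \<open>Infinite sets have cardinality 0, which is even; an odd \<open>q\<close>
    therefore forces a finite carrier.\<close>
  then have "card (carrier R) \<noteq> 0" by (metis dvd_0_right)
  then interpret finite_field R
    using R by (auto simp: finite_field_def finite_field_axioms_def intro: card_ge_0_finite)
  show "lp_norm v (proj_line R) (kakeya_maximal R F)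
      \<le> 6 * real q powr Max {y, 1 - x, 1 + y - 2 * x} * lp_norm u (carrier (heisenberg_group R)) F"
    using kakeya_maximal_bound[OF assms(1,2), of F] R by (simp add: x_def y_def)
qed simp

text \<open>Prime fields suffice: residue rings modulo odd primes provide unboundedly many field
  sizes, and comparing growth in \<open>p\<close> removes the constant.\<close>

lemma kakeya_bound_imp_ge:
  assumes uv: "1 \<le> u" "1 \<le> v" and B: "kakeya_bound u v B"
  defines "x \<equiv> real_of_ereal (1 / u)" and "y \<equiv> real_of_ereal (1 / v)"
  shows "Max {y, 1 - x, 1 + y - 2 * x} \<le> B"
proof -
  obtain C where C: "\<And>q (R :: int ring) F. odd q \<Longrightarrow> primepow q \<Longrightarrow> field R \<Longrightarrow> card (carrier R) = q \<Longrightarrow>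
      lp_norm v (proj_line R) (kakeya_maximal R F)
        \<le> C * real q powr B * lp_norm u (carrier (heisenberg_group R)) F"
    using B unfolding kakeya_bound_def by metis
  have *: "real p powr y \<le> C * real p powr B \<and> real p powr (1 - x) \<le> C * real p powr B \<and>
      real p powr (1 + y - 2 * x) \<le> C * real p powr B" if p: "prime p" "odd p" for p :: nat
  proof -
    define R where "R = residue_ring (int p)"
    interpret residues_prime p R using p by unfold_locales (simp_all add: R_def)
    interpret finite_field R by unfold_locales (rule finite)
    have card: "card (carrier R) = p" by (simp add: res_carrier_eq)
    have "primepow p" using p by simp
    then show ?thesis
      using kakeya_maximal_lower_bounds[OF uv C[OF p(2) _ is_field card]]
      by (simp add: card x_def y_def)
  qed
  have "y \<le> B" "1 - x \<le> B" "1 + y - 2 * x \<le> B"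
    using * by (blast intro: exponent_le_if_powr_bound_on_primes)+
  then show ?thesis by simp
qed

theorem theorem1p4:
  fixes u v :: ereal and A :: real
  assumes "1 \<le> u" and "1 \<le> v"
  shows "is_growth_exponent u v A \<longleftrightarrow>
    A = Max {real_of_ereal (1 / v), 1 - real_of_ereal (1 / u),
             1 + real_of_ereal (1 / v) - real_of_ereal (2 / u)}"
proof -
  have two: "real_of_ereal (2 / u) = 2 * real_of_ereal (1 / u)"
    using assms(1) by (cases u) (auto simp: one_ereal_def)
  have "0 \<le> real_of_ereal (1 / v)"
    using assms(2) by (cases v) (auto simp: real_of_ereal_inverse)
  \<comment> \<open>The candidate satisfies the sign condition in \<open>is_growth_exponent\<close>;
    upper and lower bounds then make it the least admissible exponent, which is unique by
    antisymmetry.\<close>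
  then have "0 \<le> Max {real_of_ereal (1 / v), 1 - real_of_ereal (1 / u),
      1 + real_of_ereal (1 / v) - 2 * real_of_ereal (1 / u)}"
    by (simp add: Max_ge_iff)
  then show ?thesis
    unfolding is_growth_exponent_def two
    using kakeya_bound_max_exponent[OF assms] kakeya_bound_imp_ge[OF assms]
    by (meson order_antisym)
qed

end
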